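(* Let $V$ be a finite-dimensional vector space over the finite field $\mathbb{F}_q$ and let $S$ be an $n$-dimensional subspace of $V$. Then $$\mathfrak{N}(S)=\frac{\prod_{i=0}^{n-1}(q^n-q^i)}{n!\,(q-1)^n}.$$
   Context: An atom is a one-dimensional subspace of $V$. For a subspace $S\subseteq V$, a set of atoms $\{A_1,\dots,A_k\}$ is an atomic decomposition of $S$ if $A_1+\cdots+A_k=S$. It is minimal if no proper subset of it is an atomic decomposition of $S$. $\mathfrak{N}(S)$ denotes the number of minimal atomic decompositions of $S$. *)

theory Defs
  imports Complex_Main "HOL-Library.Set_Algebras"
begin

definition atom :: "('k::field \<Rightarrow> 'v::ab_group_add \<Rightarrow> 'v) \<Rightarrow> 'v set \<Rightarrow> bool" where
  "atom scale A \<longleftrightarrow> module.subspace scale A \<and> vector_space.dim scale A = 1"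

(* The sum of sets is the elementwise (Minkowski) sum A_1 + ... + A_k from Set_Algebras;
   the empty sum is {0}. Finiteness is required because sums over infinite index sets
   default to {0}. *)
definition atomic_decomposition ::
    "('k::field \<Rightarrow> 'v::ab_group_add \<Rightarrow> 'v) \<Rightarrow> 'v set \<Rightarrow> 'v set set \<Rightarrow> bool" where
  "atomic_decomposition scale S D \<longleftrightarrow>
     finite D \<and> (\<forall>A\<in>D. atom scale A) \<and> (\<Sum>A\<in>D. A) = S"

definition minimal_atomic_decomposition ::
    "('k::field \<Rightarrow> 'v::ab_group_add \<Rightarrow> 'v) \<Rightarrow> 'v set \<Rightarrow> 'v set set \<Rightarrow> bool" where
  "minimal_atomic_decomposition scale S D \<longleftrightarrow>
     atomic_decomposition scale S D \<and> (\<forall>D'. D' \<subset> D \<longrightarrow> \<not> atomic_decomposition scale S D')"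

definition num_minimal_decompositions ::
    "('k::field \<Rightarrow> 'v::ab_group_add \<Rightarrow> 'v) \<Rightarrow> 'v set \<Rightarrow> nat" where
  "num_minimal_decompositions scale S = card {D. minimal_atomic_decomposition scale S D}"

end

theory Submission
  imports Defs "HOL-Combinatorics.Multiset_Permutations"
begin

text \<open>
  A minimal atomic decomposition of an \<open>n\<close>-dimensional space \<open>S\<close> is a basis of \<open>S\<close> in which each
  basis vector is remembered only up to a nonzero scalar. Indeed a sum of atoms is the span of their
  union, and the dimension of this span grows by one with each atom not contained in the span of
  the others considered so far. Discarding the atoms that do not enlarge the span keeps the sum and
  leaves as many atoms as the dimension, so the minimal decompositions are exactly the decompositions
  into \<open>n\<close> atoms (\<open>minimal_atomic_decomposition_iff_dim\<close>).

  The count itself is done on orderings. Build a list of atoms of \<open>S\<close>, each one outside the span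
  \<open>U\<close> of the earlier ones. If \<open>U\<close> has dimension \<open>i\<close>, then the \<open>q\<^sup>n - q\<^sup>i\<close> vectors of \<open>S - U\<close> are
  split evenly among the atoms not contained in \<open>U\<close>, each of which meets \<open>U\<close> only in \<open>0\<close> and so
  receives \<open>q - 1\<close> of them. There are thus \<open>(q\<^sup>n - q\<^sup>i) / (q - 1)\<close> choices for the next atom
  (\<open>card_atoms_outside\<close>), and the product over \<open>i < n\<close> counts the lists of length \<open>n\<close>. These are
  the orderings of the minimal decompositions, so every decomposition is counted \<open>n!\<close> times
  (\<open>independent_atom_lists_eq_orderings\<close>).
\<close>

section \<open>Atoms and sums of subspaces\<close>

context vector_space
begin

text \<open>
  This replaces the elementwise sum in the definition of a decomposition by a span, to which the
  theory of dimension applies.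
\<close>

lemma sum_subspaces_eq_span:
  assumes "finite D" and "\<And>A. A \<in> D \<Longrightarrow> subspace A"
  shows "(\<Sum>A\<in>D. A) = span (\<Union>D)"
  using assms
proof (induction D rule: finite_induct)
  case empty
  then show ?case by (simp add: set_zero)
next
  case (insert A D)
  then have "(\<Sum>A\<in>insert A D. A) = A + span (\<Union>D)" by simp
  also have "\<dots> = span A + span (\<Union>D)"
    using span_eq_iff[THEN iffD2, OF insert.prems[OF insertI1]] by (simp only:)
  also have "\<dots> = span (A \<union> \<Union>D)"
    by (auto simp: span_Un set_plus_def)
  finally show ?case by simp
qed

lemma atom_span_singleton:
  assumes "v \<noteq> 0"
  shows "atom scale (span {v})"
proof -
  have "dim {v} = 1"
    using dim_eq_card_independent[of "{v}"] assms by simp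
  then show ?thesis by (simp add: atom_def)
qed

lemma atom_imp_span_nonzero:
  assumes "atom scale A" and "v \<in> A" and "v \<noteq> 0"
  shows "A = span {v}"
proof -
  obtain B where B: "B \<subseteq> A" "independent B" "A \<subseteq> span B" "card B = dim A"
    using basis_exists by blast
  then obtain b where b: "B = {b}"
    using assms(1) by (auto simp: atom_def card_1_singleton_iff)
  then obtain c where c: "v = scale c b"
    using assms(2) B(3) by (auto simp: span_singleton)
  have "c \<noteq> 0" using c assms(3) by auto
  then have "b = scale (inverse c) v" using c by simp
  then have "b \<in> span {v}" by (metis span_base span_scale singletonI)
  then have "span {b} \<subseteq> span {v}" by (simp add: span_minimal)
  moreover have "span {v} \<subseteq> A"
    using assms(1,2) by (simp add: atom_def span_minimal)
  ultimately show ?thesis using B(3) b by auto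
qed

lemma atom_has_nonzero:
  assumes "atom scale A"
  obtains v where "v \<in> A" "v \<noteq> 0"
proof -
  have "\<not> A \<subseteq> {0}"
  proof
    assume "A \<subseteq> {0}"
    then have "dim A \<le> card ({} :: 'b set)"
      by (intro dim_le_card) auto
    then show False using assms by (simp add: atom_def)
  qed
  then show ?thesis using that by auto
qed

lemma subspace_atom: "atom scale A \<Longrightarrow> subspace A"
  by (simp add: atom_def)

lemma atomic_decomposition_iff_span:
  "atomic_decomposition scale S D \<longleftrightarrow>
     finite D \<and> (\<forall>A\<in>D. atom scale A) \<and> span (\<Union>D) = S"
  unfolding atomic_decomposition_def
  using sum_subspaces_eq_span subspace_atom by metis

end

section \<open>Minimal decompositions have as many atoms as the dimension\<close>

context finite_dimensional_vector_space
begin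

text \<open>
  An atom is spanned by a single vector, so adjoining it to a set changes the dimension exactly as
  adjoining that vector does.
\<close>

lemma dim_atom_Un:
  assumes "atom scale A"
  shows "dim (A \<union> W) = (if A \<subseteq> span W then dim W else Suc (dim W))"
proof -
  obtain v where v: "v \<in> A" "v \<noteq> 0" using atom_has_nonzero assms by blast
  have A: "A = span {v}" using atom_imp_span_nonzero assms v by blast
  have "span (A \<union> W) = span (insert v W)"
    unfolding A using span_Un[of "span {v}" W] span_Un[of "{v}" W] by (simp add: span_span)
  then have "dim (A \<union> W) = dim (insert v W)" by (metis dim_span)
  moreover have "v \<in> span W \<longleftrightarrow> A \<subseteq> span W"
    unfolding A using span_base[of v "{v}"] span_minimal[of "{v}" "span W"] by auto
  ultimately show ?thesis by (simp add: dim_insert)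
qed

lemma dim_Union_atoms_le_card:
  assumes "finite D" and "\<And>A. A \<in> D \<Longrightarrow> atom scale A"
  shows "dim (\<Union>D) \<le> card D"
  using assms
proof (induction D rule: finite_induct)
  case (insert A D)
  then show ?case by (auto simp: dim_atom_Un)
qed simp

text \<open>
  The analogue for atoms of extracting a basis from a spanning set: going through \<open>D\<close> one atom at a
  time, keep an atom only if it is not already in the span, that is, only if it raises the dimension.
\<close>

lemma atoms_contain_decomposition_of_dim_size:
  assumes "finite D" and "\<And>A. A \<in> D \<Longrightarrow> atom scale A"
  obtains D' where "D' \<subseteq> D" "span (\<Union>D') = span (\<Union>D)" "card D' \<le> dim (\<Union>D)"
proof -
  have "\<exists>D'\<subseteq>D. span (\<Union>D') = span (\<Union>D) \<and> card D' \<le> dim (\<Union>D)"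
    using assms
  proof (induction D rule: finite_induct)
    case (insert A D)
    then obtain D' where D': "D' \<subseteq> D" "span (\<Union>D') = span (\<Union>D)" "card D' \<le> dim (\<Union>D)"
      by auto
    show ?case
    proof (cases "A \<subseteq> span (\<Union>D)")
      case True
      then have "span (A \<union> \<Union>D) = span (\<Union>D)"
        unfolding span_eq using span_superset[of "\<Union>D"] span_superset[of "A \<union> \<Union>D"] by blast
      moreover have "dim (A \<union> \<Union>D) = dim (\<Union>D)"
        using insert.prems True by (simp add: dim_atom_Un)
      ultimately show ?thesis using D' by (intro exI[of _ D']) auto
    next
      case False
      have "span (A \<union> \<Union>D') = span (A \<union> \<Union>D)"
        using D'(2) by (simp add: span_Un)
      moreover have "card (insert A D') \<le> Suc (card D')" by (rule card_insert_le_m1) auto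
      ultimately show ?thesis using D' False insert.prems
        by (intro exI[of _ "insert A D'"]) (auto simp: dim_atom_Un)
    qed
  qed auto
  then show ?thesis using that by blast
qed

text \<open>
  A decomposition contains one with at most \<open>dim S\<close> atoms, so a minimal one has no more than that;
  and fewer than \<open>dim S\<close> atoms cannot span \<open>S\<close>, which gives both the reverse inequality and the
  minimality of any decomposition with exactly \<open>dim S\<close> atoms. The right-hand side states
  that \<open>D\<close> spans through its dimension, because equality of the dimension with the number
  of atoms also makes sense for the shorter lists from which the orderings are built up below.
\<close>

lemma minimal_atomic_decomposition_iff_dim:
  assumes "subspace S"
  shows "minimal_atomic_decomposition scale S D \<longleftrightarrow>
    finite D \<and> (\<forall>A\<in>D. atom scale A \<and> A \<subseteq> S) \<and> card D = dim S \<and> dim (\<Union>D) = dim S"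
    (is "?min \<longleftrightarrow> ?R")
proof
  assume min: ?min
  then have D: "finite D" "\<And>A. A \<in> D \<Longrightarrow> atom scale A" "span (\<Union>D) = S"
    by (auto simp: minimal_atomic_decomposition_def atomic_decomposition_iff_span)
  then have dimD: "dim (\<Union>D) = dim S" by (metis dim_span)
  obtain D' where D': "D' \<subseteq> D" "span (\<Union>D') = span (\<Union>D)" "card D' \<le> dim (\<Union>D)"
    using atoms_contain_decomposition_of_dim_size D(1,2) by blast
  have "atomic_decomposition scale S D'"
    unfolding atomic_decomposition_iff_span
    using D D' finite_subset by auto
  then have "D' = D"
    using min D'(1) unfolding minimal_atomic_decomposition_def by blast
  then have "card D = dim S"
    using D' dimD dim_Union_atoms_le_card[OF D(1,2)] by simp
  moreover have "\<And>A. A \<in> D \<Longrightarrow> A \<subseteq> S" using D(3) span_superset by blast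
  ultimately show ?R using D dimD by auto
next
  assume R: ?R
  have "\<Union>D \<subseteq> S" using R by auto
  then have "span (\<Union>D) \<subseteq> S" using assms span_minimal by blast
  then have "span (\<Union>D) = S"
    using R by (intro subspace_dim_equal) (auto simp: assms)
  then have "atomic_decomposition scale S D"
    using R by (simp add: atomic_decomposition_iff_span)
  moreover have "\<not> atomic_decomposition scale S D'" if "D' \<subset> D" for D'
  proof
    assume "atomic_decomposition scale S D'"
    then have "dim S \<le> card D'"
      using dim_Union_atoms_le_card[of D'] dim_span[of "\<Union>D'"]
      by (auto simp: atomic_decomposition_iff_span)
    moreover have "card D' < card D" using that R psubset_card_mono by blast
    ultimately show False using R by simp
  qed
  ultimately show ?min by (simp add: minimal_atomic_decomposition_def)
qed

end

section \<open>Counting over a finite field\<close>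

locale finite_field_vector_space =
  finite_dimensional_vector_space scale Basis
  for scale :: "'k::{field,finite} \<Rightarrow> 'v::ab_group_add \<Rightarrow> 'v" and Basis +
  fixes q :: nat
  assumes q_eq_card: "q = card (UNIV :: 'k set)"
begin

text \<open>
  Each new basis vector \<open>b\<close> multiplies the size by \<open>q\<close>: a vector of the larger span is \<open>k b + x\<close>
  for a unique scalar \<open>k\<close> and a unique \<open>x\<close> in the smaller span.
\<close>

lemma card_span_independent:
  assumes "finite B" and "independent B"
  shows "finite (span B) \<and> card (span B) = q ^ card B"
  using assms
proof (induction B rule: finite_induct)
  case (insert b B)
  have IH: "finite (span B)" "card (span B) = q ^ card B" and b: "b \<notin> span B"
    using insert by (auto simp: independent_insert)
  let ?f = "\<lambda>(k, x). scale k b + x"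
  have "inj_on ?f (UNIV \<times> span B)"
  proof (rule inj_onI, clarify)
    fix k x l y
    assume xy: "x \<in> span B" "y \<in> span B" and eq: "scale k b + x = scale l b + y"
    have "scale (k - l) b = y - x" using eq by (simp add: scale_left_diff_distrib algebra_simps)
    then have "scale (k - l) b \<in> span B" using xy by (simp add: span_diff)
    then have "scale (inverse (k - l)) (scale (k - l) b) \<in> span B" by (rule span_scale)
    then have "k = l" using b by (cases "k = l") simp_all
    then show "k = l \<and> x = y" using eq by simp
  qed
  moreover have "span (insert b B) = ?f ` (UNIV \<times> span B)"
  proof (intro equalityI subsetI)
    fix v assume "v \<in> span (insert b B)"
    then obtain k where "v - scale k b \<in> span B" by (auto simp: span_breakdown_eq)
    then show "v \<in> ?f ` (UNIV \<times> span B)"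
      by (intro image_eqI[of _ _ "(k, v - scale k b)"]) auto
  next
    fix v assume "v \<in> ?f ` (UNIV \<times> span B)"
    then obtain k x where "v = scale k b + x" "x \<in> span B" by auto
    then show "v \<in> span (insert b B)"
      unfolding span_breakdown_eq by (intro exI[of _ k]) simp
  qed
  ultimately have "finite (span (insert b B))" 
    "card (span (insert b B)) = card ((UNIV :: 'k set) \<times> span B)"
    using IH by (auto simp: card_image)
  then show ?case using IH insert by (simp add: card_cartesian_product q_eq_card)
qed simp

lemma
  assumes "subspace U"
  shows finite_subspace: "finite U" and card_subspace: "card U = q ^ dim U"
proof -
  obtain B where B: "B \<subseteq> U" "independent B" "U \<subseteq> span B" "card B = dim U"
    using basis_exists by blast
  have "U = span B" using B assms span_minimal by blast
  then show "finite U" "card U = q ^ dim U"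
    using card_span_independent[of B] B finiteI_independent by auto
qed

text \<open>
  Every nonzero vector lies in exactly one atom, its span. Hence the atoms of \<open>S\<close> not contained in
  \<open>U\<close>, with \<open>0\<close> removed, partition \<open>S - U\<close> into blocks of size \<open>q - 1\<close>.
\<close>

lemma card_atoms_outside:
  assumes "subspace S" and "subspace U" and "U \<subseteq> S"
  shows "card {A. atom scale A \<and> A \<subseteq> S \<and> \<not> A \<subseteq> U} * (q - 1) = q ^ dim S - q ^ dim U"
proof -
  let ?C = "{A. atom scale A \<and> A \<subseteq> S \<and> \<not> A \<subseteq> U}"
  have meet: "A = span {v}" if "A \<in> ?C" "v \<in> A - {0}" for A v
    using that atom_imp_span_nonzero by auto
  have cover: "S - U = (\<Union>A\<in>?C. A - {0})"
  proof (intro equalityI subsetI)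
    fix v assume v: "v \<in> S - U"
    then have "v \<noteq> 0" using assms(2) subspace_0 by blast
    moreover have "span {v} \<subseteq> S" using v assms(1) span_minimal by simp
    moreover have "\<not> span {v} \<subseteq> U" using v span_base by blast
    ultimately have "span {v} \<in> ?C" "v \<in> span {v} - {0}"
      using atom_span_singleton span_base by auto
    then show "v \<in> (\<Union>A\<in>?C. A - {0})" by blast
  next
    fix v assume "v \<in> (\<Union>A\<in>?C. A - {0})"
    then obtain A where A: "A \<in> ?C" "v \<in> A - {0}" by blast
    then have "v \<notin> U" using meet[OF A] span_minimal[of "{v}" U] assms(2) by auto
    then show "v \<in> S - U" using A by auto
  qed
  have "finite (Pow S)" using finite_subspace assms(1) by simp
  then have fin: "finite ?C" by (rule rev_finite_subset) auto
  have "card (S - U) = (\<Sum>A\<in>?C. card (A - {0}))"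
    unfolding cover
  proof (rule card_UN_disjoint[OF fin])
    show "\<forall>A\<in>?C. finite (A - {0})" using finite_subspace subspace_atom by auto
    show "\<forall>A\<in>?C. \<forall>B\<in>?C. A \<noteq> B \<longrightarrow> (A - {0}) \<inter> (B - {0}) = {}"
      using meet by blast
  qed
  also have "\<dots> = (\<Sum>A\<in>?C. q - 1)"
  proof (rule sum.cong[OF refl])
    fix A assume "A \<in> ?C"
    then have A: "subspace A" "dim A = 1" by (auto simp: atom_def)
    then show "card (A - {0}) = q - 1"
      using card_subspace[OF A(1)] subspace_0[OF A(1)] by (simp add: card_Diff_singleton)
  qed
  finally have "card (S - U) = card ?C * (q - 1)" by simp
  moreover have "card (S - U) = card S - card U"
    using assms finite_subspace by (simp add: card_Diff_subset)
  ultimately show ?thesis using card_subspace assms by simp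
qed

text \<open>
  Independence is expressed by the dimension of the union. As \<open>m\<close> atoms span dimension at
  most \<open>m\<close>, equality forces the atoms to be distinct and every atom to lie outside the span of those
  after it in the list.
\<close>

definition independent_atom_lists :: "'v set \<Rightarrow> nat \<Rightarrow> 'v set list set" where
  "independent_atom_lists S m =
    {As. length As = m \<and> (\<forall>A\<in>set As. atom scale A \<and> A \<subseteq> S) \<and> dim (\<Union>(set As)) = m}"

lemma finite_independent_atom_lists:
  assumes "subspace S"
  shows "finite (independent_atom_lists S m)"
proof (rule finite_subset)
  show "independent_atom_lists S m \<subseteq> {As. set As \<subseteq> Pow S \<and> length As = m}"
    by (auto simp: independent_atom_lists_def)
  show "finite {As. set As \<subseteq> Pow S \<and> length As = m}"
    using finite_subspace assms by (intro finite_lists_length_eq) simp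
qed

text \<open>
  If the longer list has full dimension, then so has its tail: the tail cannot have dimension
  \<open>Suc m\<close> with only \<open>m\<close> atoms, so the head must account for the last step.
\<close>

lemma Cons_in_independent_atom_lists_iff:
  "A # As \<in> independent_atom_lists S (Suc m) \<longleftrightarrow>
    As \<in> independent_atom_lists S m \<and>
    A \<in> {A. atom scale A \<and> A \<subseteq> S \<and> \<not> A \<subseteq> span (\<Union>(set As))}"
proof -
  have "dim (\<Union>(set As)) \<le> length As" if "\<forall>A\<in>set As. atom scale A"
    using dim_Union_atoms_le_card[of "set As"] card_length[of As] that by auto
  then show ?thesis
    by (auto simp: independent_atom_lists_def dim_atom_Un split: if_splits)
qed

text \<open>
  The number of ways to extend a list depends only on its length, because that is the dimension of
  its span. The powers of \<open>q - 1\<close> are kept on the left so that the identity holds in the natural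
  numbers; it is valid for every \<open>m\<close>, both sides being \<open>0\<close> when \<open>m > dim S\<close>, where the factor
  for \<open>i = dim S\<close> vanishes.
\<close>

lemma card_independent_atom_lists:
  assumes "subspace S"
  shows "card (independent_atom_lists S m) * (q - 1) ^ m = (\<Prod>i = 0..<m. q ^ dim S - q ^ i)"
proof (induction m)
  case 0
  have "independent_atom_lists S 0 = {[]}" by (auto simp: independent_atom_lists_def)
  then show ?case by simp
next
  case (Suc m)
  let ?L = "independent_atom_lists S"
  let ?X = "\<lambda>As. {A. atom scale A \<and> A \<subseteq> S \<and> \<not> A \<subseteq> span (\<Union>(set As))}"
  have "finite (Pow S)" using finite_subspace assms by simp
  then have finX: "finite (?X As)" for As by (rule rev_finite_subset) auto
  have "?L (Suc m) = (\<lambda>(As, A). A # As) ` (SIGMA As : ?L m. ?X As)"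
  proof (intro equalityI subsetI)
    fix Bs assume Bs: "Bs \<in> ?L (Suc m)"
    then obtain A As where "Bs = A # As"
      by (cases Bs) (auto simp: independent_atom_lists_def)
    then show "Bs \<in> (\<lambda>(As, A). A # As) ` (SIGMA As : ?L m. ?X As)"
      using Bs Cons_in_independent_atom_lists_iff by force
  qed (auto simp: Cons_in_independent_atom_lists_iff)
  moreover have "inj_on (\<lambda>(As, A). A # As) (SIGMA As : ?L m. ?X As)"
    by (auto simp: inj_on_def)
  ultimately have "card (?L (Suc m)) = (\<Sum>As\<in>?L m. card (?X As))"
    using finite_independent_atom_lists[OF assms] finX by (simp add: card_image)
  then have "card (?L (Suc m)) * (q - 1) = (\<Sum>As\<in>?L m. card (?X As) * (q - 1))"
    by (simp add: sum_distrib_right)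
  also have "\<dots> = (\<Sum>As\<in>?L m. q ^ dim S - q ^ m)"
  proof (rule sum.cong[OF refl])
    fix As assume As: "As \<in> ?L m"
    then have "span (\<Union>(set As)) \<subseteq> S"
      using assms by (intro span_minimal) (auto simp: independent_atom_lists_def)
    then show "card (?X As) * (q - 1) = q ^ dim S - q ^ m"
      using card_atoms_outside[OF assms subspace_span] As
      by (simp add: independent_atom_lists_def)
  qed
  finally have step: "card (?L (Suc m)) * (q - 1) = card (?L m) * (q ^ dim S - q ^ m)" by simp
  have "card (?L (Suc m)) * (q - 1) ^ Suc m = card (?L (Suc m)) * (q - 1) * (q - 1) ^ m"
    by (simp only: power_Suc mult.assoc)
  also have "\<dots> = card (?L m) * (q - 1) ^ m * (q ^ dim S - q ^ m)"
    unfolding step by (simp only: mult_ac)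
  also have "\<dots> = (\<Prod>i = 0..<Suc m. q ^ dim S - q ^ i)"
    by (simp only: Suc.IH prod.atLeast0_lessThan_Suc)
  finally show ?case .
qed

lemma independent_atom_lists_eq_orderings:
  assumes "subspace S"
  shows "independent_atom_lists S (dim S) =
    (\<Union>D\<in>{D. minimal_atomic_decomposition scale S D}. permutations_of_set D)"
proof (intro equalityI subsetI)
  fix As assume As: "As \<in> independent_atom_lists S (dim S)"
  then have "length As \<le> card (set As)"
    using dim_Union_atoms_le_card[of "set As"] by (auto simp: independent_atom_lists_def)
  then have dist: "distinct As"
    using card_length[of As] by (intro card_distinct) simp
  then have "minimal_atomic_decomposition scale S (set As)"
    unfolding minimal_atomic_decomposition_iff_dim[OF assms]
    using As distinct_card[OF dist] by (simp add: independent_atom_lists_def)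
  then show "As \<in> (\<Union>D\<in>{D. minimal_atomic_decomposition scale S D}. permutations_of_set D)"
    using dist by blast
next
  fix As assume "As \<in> (\<Union>D\<in>{D. minimal_atomic_decomposition scale S D}. permutations_of_set D)"
  then have "minimal_atomic_decomposition scale S (set As)" and dist: "distinct As"
    by (auto dest: permutations_of_setD)
  then show "As \<in> independent_atom_lists S (dim S)"
    unfolding minimal_atomic_decomposition_iff_dim[OF assms]
    using distinct_card[OF dist] by (simp add: independent_atom_lists_def)
qed

lemma card_independent_atom_lists_dim:
  assumes "subspace S"
  shows "card (independent_atom_lists S (dim S)) =
    num_minimal_decompositions scale S * fact (dim S)"
proof -
  let ?M = "{D. minimal_atomic_decomposition scale S D}"
  note iff = minimal_atomic_decomposition_iff_dim[OF assms]
  have "finite (Pow (Pow S))" using finite_subspace assms by simp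
  then have finM: "finite ?M"
    by (rule rev_finite_subset) (auto simp: iff)
  have "card (independent_atom_lists S (dim S)) = (\<Sum>D\<in>?M. card (permutations_of_set D))"
    unfolding independent_atom_lists_eq_orderings[OF assms]
    by (rule card_UN_disjoint[OF finM]) (auto dest: permutations_of_setD)
  also have "\<dots> = (\<Sum>D\<in>?M. fact (dim S))"
    by (intro sum.cong) (auto simp: iff)
  finally show ?thesis by (simp add: num_minimal_decompositions_def)
qed

end

theorem theorem1:
  fixes scale :: "'k::{field,finite} \<Rightarrow> 'v::ab_group_add \<Rightarrow> 'v"
    and Basis S :: "'v set"
    and n q :: nat
  assumes "finite_dimensional_vector_space scale Basis"
    and "q = card (UNIV :: 'k set)"
    and "module.subspace scale S"
    and "vector_space.dim scale S = n"
  shows "real (num_minimal_decompositions scale S) =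
           (\<Prod>i = 0..<n. real q ^ n - real q ^ i) / (fact n * (real q - 1) ^ n)"
proof -
  interpret V: finite_field_vector_space scale Basis q
    using assms(1,2) by (intro finite_field_vector_space.intro finite_field_vector_space_axioms.intro)
  \<comment> \<open>The field has two distinct elements, so the division by \<open>(q - 1)\<^sup>n\<close> is by a nonzero number.\<close>
  have "card {0, 1 :: 'k} \<le> q"
    unfolding assms(2) by (rule card_mono) auto
  then have q: "q \<ge> 2" by simp
  have "num_minimal_decompositions scale S * fact n * (q - 1) ^ n = (\<Prod>i = 0..<n. q ^ n - q ^ i)"
    using V.card_independent_atom_lists[OF assms(3), of n]
      V.card_independent_atom_lists_dim[OF assms(3)] assms(4) by simp
  then have "real (num_minimal_decompositions scale S * fact n * (q - 1) ^ n)
      = real (\<Prod>i = 0..<n. q ^ n - q ^ i)" by (rule arg_cong)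
  moreover have "real (\<Prod>i = 0..<n. q ^ n - q ^ i) = (\<Prod>i = 0..<n. real q ^ n - real q ^ i)"
    unfolding of_nat_prod
    using q by (intro prod.cong) (auto simp: of_nat_diff power_increasing)
  ultimately show ?thesis
    using q by (simp add: field_simps of_nat_diff)
qed

end
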